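(* There exists a unique equilateral proper spherical triangle all of whose sides and angles are rational; its sides all have length $\frac{\pi}{2}$ and its angles all measure $\frac{\pi}{2}$. Moreover, the medians of this triangle have length $\frac{\pi}{2}$, and are therefore rational.
   Context: A spherical triangle lies on the unit sphere and has sides that are arcs of great circles; it is proper if its three side lengths and its three angles all lie in $(0,\pi)$. An angle or length $x$ is called rational if $\sin x,\cos x\in\mathbb{Q}$ (equivalently $e^{ix}\in\mathbb{Q}(i)$). A median is the great-circle arc from a vertex to the midpoint of the opposite side. *)

theory Defs
  imports "HOL-Analysis.Analysis"
begin

definition rational_angle :: "real \<Rightarrow> bool" where
  "rational_angle x \<longleftrightarrow> sin x \<in> \<rat> \<and> cos x \<in> \<rat>"

text \<open>
  Triangles are given by their vertices on the unit sphere of \<open>real ^ 3\<close>. A great-circle arc of length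
  in \<open>(0, pi)\<close> is the shorter arc joining its end points, so the sides of a proper triangle are
  determined by its vertices, and its angles are those between the sides at each vertex.
\<close>

definition sphere_dist :: "real ^ 3 \<Rightarrow> real ^ 3 \<Rightarrow> real" where
  "sphere_dist A B = arccos (A \<bullet> B)"

text \<open>
  The shorter great-circle arc is the central projection of the chord (recall that \<open>sgn x\<close> is
  \<open>x\<close> divided by its norm). This is meaningful only for end points that are not antipodal.
\<close>

definition great_arc :: "real ^ 3 \<Rightarrow> real ^ 3 \<Rightarrow> (real ^ 3) set" where
  "great_arc A B = sgn ` closed_segment A B"

definition arc_midpoint :: "real ^ 3 \<Rightarrow> real ^ 3 \<Rightarrow> real ^ 3" where
  "arc_midpoint A B = (THE M. M \<in> great_arc A B \<and> sphere_dist A M = sphere_dist M B)"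

text \<open>
  Component of \<open>B\<close> orthogonal to \<open>A\<close>: it points in the initial direction of the arc from \<open>A\<close> to \<open>B\<close>,
  and vanishes exactly if \<open>B\<close> is \<open>A\<close> or its antipode.
\<close>

definition tangent :: "real ^ 3 \<Rightarrow> real ^ 3 \<Rightarrow> real ^ 3" where
  "tangent A B = B - (A \<bullet> B) *\<^sub>R A"

text \<open>
  Angle at the vertex \<open>A\<close> between the arcs to \<open>B\<close> and to \<open>C\<close>. If one of the tangents vanishes, this has
  the junk value \<open>pi / 2\<close>; in a proper triangle the bounds on the sides exclude that case.
\<close>

definition sphere_angle :: "real ^ 3 \<Rightarrow> real ^ 3 \<Rightarrow> real ^ 3 \<Rightarrow> real" where
  "sphere_angle A B C =
     arccos ((tangent A B \<bullet> tangent A C) / (norm (tangent A B) * norm (tangent A C)))"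

definition side_lengths :: "real ^ 3 \<Rightarrow> real ^ 3 \<Rightarrow> real ^ 3 \<Rightarrow> real set" where
  "side_lengths A B C = {sphere_dist B C, sphere_dist C A, sphere_dist A B}"

definition angles :: "real ^ 3 \<Rightarrow> real ^ 3 \<Rightarrow> real ^ 3 \<Rightarrow> real set" where
  "angles A B C = {sphere_angle A B C, sphere_angle B C A, sphere_angle C A B}"

definition median_lengths :: "real ^ 3 \<Rightarrow> real ^ 3 \<Rightarrow> real ^ 3 \<Rightarrow> real set" where
  "median_lengths A B C =
     {sphere_dist A (arc_midpoint B C), sphere_dist B (arc_midpoint C A),
      sphere_dist C (arc_midpoint A B)}"

definition proper_spherical_triangle :: "real ^ 3 \<Rightarrow> real ^ 3 \<Rightarrow> real ^ 3 \<Rightarrow> bool" where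
  "proper_spherical_triangle A B C \<longleftrightarrow>
     {A, B, C} \<subseteq> sphere 0 1 \<and>
     side_lengths A B C \<subseteq> {0<..<pi} \<and> angles A B C \<subseteq> {0<..<pi}"

definition equilateral :: "real ^ 3 \<Rightarrow> real ^ 3 \<Rightarrow> real ^ 3 \<Rightarrow> bool" where
  "equilateral A B C \<longleftrightarrow>
     sphere_dist B C = sphere_dist C A \<and> sphere_dist C A = sphere_dist A B"

definition rational_sides_and_angles :: "real ^ 3 \<Rightarrow> real ^ 3 \<Rightarrow> real ^ 3 \<Rightarrow> bool" where
  "rational_sides_and_angles A B C \<longleftrightarrow>
     (\<forall>x \<in> side_lengths A B C \<union> angles A B C. rational_angle x)"

text \<open>The isometries of the sphere are the restrictions of the orthogonal maps.\<close>

definition congruent_triangles ::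
  "real ^ 3 \<Rightarrow> real ^ 3 \<Rightarrow> real ^ 3 \<Rightarrow> real ^ 3 \<Rightarrow> real ^ 3 \<Rightarrow> real ^ 3 \<Rightarrow> bool" where
  "congruent_triangles A B C A' B' C' \<longleftrightarrow>
     (\<exists>f. orthogonal_transformation f \<and> f A = A' \<and> f B = B' \<and> f C = C')"

definition rational_equilateral_triangle :: "real ^ 3 \<Rightarrow> real ^ 3 \<Rightarrow> real ^ 3 \<Rightarrow> bool" where
  "rational_equilateral_triangle A B C \<longleftrightarrow>
     proper_spherical_triangle A B C \<and> equilateral A B C \<and> rational_sides_and_angles A B C"

end

theory Submission
  imports Defs "HOL-Computational_Algebra.Nth_Powers"
begin

text \<open>
  Let \<open>c\<close> and \<open>s\<close> be the cosine and the sine of the common side and put \<open>r = (1 + c) sin \<alpha>\<close>, where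
  \<open>\<alpha>\<close> is the common angle. As \<open>cos \<alpha> = c / (1 + c)\<close>, we have \<open>s\<^sup>2 = 1 - c\<^sup>2\<close> and \<open>r\<^sup>2 = 1 + 2 c\<close>, whence
  \<open>s\<^sup>4 - s\<^sup>2 r\<^sup>2 + r\<^sup>4 = (c\<^sup>2 + c + 1)\<^sup>2\<close>. By a classical infinite descent the quartic form on the left
  takes square values at positive rationals only if \<open>s = r\<close>; this gives \<open>c (c + 2) = 0\<close> and so \<open>c = 0\<close>.
\<close>

section \<open>Factorizations and Pythagorean triples over the integers\<close>

lemma coprime_mult_eq_square:
  fixes p q k :: int
  assumes "p > 0" "q > 0" "coprime p q" "p * q = k\<^sup>2"
  obtains a b where "a > 0" "b > 0" "p = a\<^sup>2" "q = b\<^sup>2"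
proof -
  have "int (nat p * nat q) = int ((nat \<bar>k\<bar>)\<^sup>2)"
    using assms by simp
  then have "nat p * nat q = (nat \<bar>k\<bar>)\<^sup>2"
    by (simp only: of_nat_eq_iff)
  then have "is_nth_power 2 (nat p * nat q)"
    by (metis is_nth_power_nth_power)
  moreover have "coprime (nat p) (nat q)"
    using assms by (simp flip: coprime_int_iff)
  ultimately have "is_nth_power 2 (nat p)" "is_nth_power 2 (nat q)"
    using is_nth_power_mult_coprime_natD assms by auto
  then obtain u v where uv: "nat p = u\<^sup>2" "nat q = v\<^sup>2"
    by (auto elim!: is_nth_powerE)
  show thesis
  proof (rule that[of "int u" "int v"])
    show "p = (int u)\<^sup>2" "q = (int v)\<^sup>2"
      using uv assms by (metis int_nat_eq of_nat_power less_imp_le)+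
    then show "int u > 0" "int v > 0"
      using assms by (auto intro!: Nat.gr0I)
  qed
qed

text \<open>The halves of \<open>\<bar>z\<bar> + m\<close> and \<open>\<bar>z\<bar> - m\<close> are
  coprime with product \<open>(n / 2)\<^sup>2\<close>, so both are squares. The signs of
  \<open>m\<close> and \<open>z\<close> are left free because the lemma is applied to a difference
  of squares of unknown sign.\<close>

lemma primitive_pythagorean_triple:
  fixes m n z :: int
  assumes "odd m" "even n" "n > 0" "coprime m n" "m\<^sup>2 + n\<^sup>2 = z\<^sup>2"
  obtains a b where "a > 0" "b > 0" "coprime a b" "m = a\<^sup>2 - b\<^sup>2" "n = 2 * a * b"
proof -
  obtain k where k: "n = 2 * k" using \<open>even n\<close> by blast
  have "n\<^sup>2 > 0" using \<open>n > 0\<close> by simp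
  then have "m\<^sup>2 < \<bar>z\<bar>\<^sup>2" using assms(5) unfolding power2_abs by linarith
  then have lt: "\<bar>m\<bar> < \<bar>z\<bar>" using power2_less_imp_less[of "\<bar>m\<bar>" "\<bar>z\<bar>"] by simp
  have "odd (z\<^sup>2)" using assms by (metis even_add even_power zero_less_numeral)
  then have "odd \<bar>z\<bar>" by simp
  then obtain p where p: "\<bar>z\<bar> + m = 2 * p" using \<open>odd m\<close> by (metis evenE odd_even_add)
  define q where "q = p - m"
  have q: "\<bar>z\<bar> - m = 2 * q" using p by (simp add: q_def)
  have pos: "p > 0" "q > 0" using p q lt by auto
  have "4 * (p * q) = (\<bar>z\<bar> + m) * (\<bar>z\<bar> - m)" using p q by simp
  also have "\<dots> = \<bar>z\<bar>\<^sup>2 - m\<^sup>2" by (simp add: power2_eq_square algebra_simps)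
  also have "\<dots> = 4 * k\<^sup>2" using assms k by (simp add: power2_eq_square)
  finally have pq: "p * q = k\<^sup>2" by simp
  have "coprime p q"
  proof (rule coprimeI)
    fix d assume d: "d dvd p" "d dvd q"
    then have "d dvd m" using q_def by (metis dvd_diff_right_iff dvd_diff_commute)
    moreover have "d\<^sup>2 dvd k\<^sup>2" using d pq by (metis mult_dvd_mono power2_eq_square)
    then have "d dvd n" using k by simp
    ultimately show "is_unit d" using \<open>coprime m n\<close> by (metis coprime_common_divisor)
  qed
  with pos pq obtain a b where ab: "a > 0" "b > 0" "p = a\<^sup>2" "q = b\<^sup>2"
    using coprime_mult_eq_square by metis
  show thesis
  proof (rule that[OF ab(1,2)])
    show "coprime a b" using \<open>coprime p q\<close> ab by simp
    show "m = a\<^sup>2 - b\<^sup>2" using ab q_def by simp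
    have "(a * b)\<^sup>2 = k\<^sup>2" using pq ab by (simp add: power_mult_distrib)
    moreover have "k > 0" using k \<open>n > 0\<close> by simp
    ultimately have "a * b = k" using ab by (simp add: power2_eq_iff_nonneg)
    then show "n = 2 * a * b" using k by simp
  qed
qed

lemma four_number_lemma:
  fixes x y a b :: int
  assumes "x > 0" "y > 0" "a > 0" "b > 0" "x * y = a * b"
  obtains r s t w where "r > 0" "s > 0" "t > 0" "w > 0"
    "x = r * s" "y = t * w" "a = r * t" "b = s * w"
proof -
  obtain r s where rs: "x = r * s" "r dvd a" "s dvd b"
    using division_decomp[of x a b] assms(5) by (metis dvd_triv_left)
  \<comment> \<open>The divisors \<open>r\<close> and \<open>s\<close> have equal but unknown signs;
    their absolute values still multiply to \<open>x\<close>.\<close>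
  define R S where "R = \<bar>r\<bar>" and "S = \<bar>s\<bar>"
  have x: "x = R * S" using rs(1) assms(1) by (simp add: R_def S_def flip: abs_mult)
  have "R dvd a" "S dvd b" using rs by (simp_all add: R_def S_def)
  then obtain t w where tw: "a = R * t" "b = S * w" by (elim dvdE)
  have RS: "R > 0" "S > 0" using x \<open>x > 0\<close> by (auto simp: R_def S_def)
  have "(R * S) * y = (R * S) * (t * w)" using assms(5) x tw by (simp add: algebra_simps)
  then have "y = t * w" using RS by simp
  with RS x tw assms that show thesis by (metis zero_less_mult_pos)
qed

section \<open>Infinite descent for the quartic form, over the integers and then the
  rationals\<close>

lemma coprime_diff_squares:
  fixes x y :: int
  assumes "coprime x y"
  shows "coprime (x\<^sup>2 - y\<^sup>2) (x * y)"
proof -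
  \<comment> \<open>Written as a multiple plus a remainder, so that \<open>gcd_add_mult\<close>
    drops the multiple.\<close>
  have "coprime x (- x * x + y\<^sup>2)" "coprime y (- y * y + x\<^sup>2)"
    using assms by (simp_all only: coprime_iff_gcd_eq_1 gcd_add_mult)
      (simp_all add: coprime_commute flip: coprime_iff_gcd_eq_1)
  then have "coprime x (- (x\<^sup>2 - y\<^sup>2))" "coprime y (x\<^sup>2 - y\<^sup>2)"
    by (simp_all add: power2_eq_square algebra_simps)
  then show ?thesis by (simp add: coprime_commute del: minus_diff_eq)
qed

text \<open>The two sums differ by \<open>3 * r\<^sup>2\<close>. The first is coprime to
  \<open>r\<^sup>2\<close>, and also to 3: squares are 0 or 1 modulo 3, so 3 divides a sum of two
  squares only if it divides both roots.\<close>

lemma coprime_sum_squares: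
  fixes w r :: int
  assumes "coprime r w"
  shows "coprime (w\<^sup>2 + r\<^sup>2) (w\<^sup>2 + 4 * r\<^sup>2)"
proof -
  have "coprime (r\<^sup>2) (1 * r\<^sup>2 + w\<^sup>2)"
    using assms unfolding coprime_iff_gcd_eq_1 gcd_add_mult by (simp flip: coprime_iff_gcd_eq_1)
  moreover have "\<not> 3 dvd w\<^sup>2 + r\<^sup>2"
  proof
    assume *: "3 dvd w\<^sup>2 + r\<^sup>2"
    have sq: "n\<^sup>2 mod 3 = (if 3 dvd n then 0 else 1)" for n :: int
    proof -
      have "n mod 3 = 0 \<or> n mod 3 = 1 \<or> n mod 3 = 2" by presburger
      then show ?thesis by (elim disjE; subst power_mod[symmetric]; simp add: dvd_eq_mod_eq_0)
    qed
    have "(w\<^sup>2 mod 3 + r\<^sup>2 mod 3) mod 3 = 0" using * by presburger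
    then have "3 dvd w \<and> 3 dvd r" unfolding sq by (simp split: if_splits)
    then have "is_unit (3 :: int)" using assms coprime_common_divisor by blast
    then show False by simp
  qed
  then have "coprime 3 (w\<^sup>2 + r\<^sup>2)" using prime_imp_coprime[of "3 :: int"] by simp
  ultimately have "coprime (w\<^sup>2 + r\<^sup>2) (3 * r\<^sup>2)"
    by (simp add: coprime_commute add.commute)
  then have "coprime (w\<^sup>2 + r\<^sup>2) (1 * (w\<^sup>2 + r\<^sup>2) + 3 * r\<^sup>2)"
    unfolding coprime_iff_gcd_eq_1 gcd_add_mult .
  then show ?thesis by (simp add: algebra_simps)
qed

text \<open>Descent on \<open>x * y\<close>. The form equals
  \<open>(y\<^sup>2 - x\<^sup>2)\<^sup>2 + (x * y)\<^sup>2\<close>, a primitive Pythagorean triple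
  with even leg \<open>x * y\<close>. Parametrizing it, splitting \<open>x * y\<close> into four
  factors and parametrizing once more yields a smaller solution, again with an even entry.\<close>

lemma quartic_not_square_even:
  fixes x y z :: int
  assumes "x > 0" "y > 0" "coprime x y" "even x" "x^4 - x\<^sup>2 * y\<^sup>2 + y^4 = z\<^sup>2"
  shows False
  using assms
proof (induction "nat (x * y)" arbitrary: x y z rule: less_induct)
  case less
  have "odd y" using less.prems by (metis coprime_common_divisor odd_one)
  have "coprime (y\<^sup>2 - x\<^sup>2) (x * y)"
    using coprime_diff_squares[of y x] less.prems(3) by (simp add: coprime_commute mult.commute)
  moreover have "(y\<^sup>2 - x\<^sup>2)\<^sup>2 + (x * y)\<^sup>2 = z\<^sup>2"
    using less.prems(5) by (simp add: power2_eq_square power4_eq_xxxx algebra_simps)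
  ultimately obtain a b where ab: "a > 0" "b > 0" "coprime a b"
      "y\<^sup>2 - x\<^sup>2 = a\<^sup>2 - b\<^sup>2" "x * y = 2 * a * b"
    using less.prems \<open>odd y\<close> primitive_pythagorean_triple[of "y\<^sup>2 - x\<^sup>2" "x * y" z] by auto
  obtain k where k: "x = 2 * k" using less.prems by blast
  have "k > 0" "k * y = b * a" using ab k less.prems by auto
  then obtain r s t w where rstw: "r > 0" "s > 0" "t > 0" "w > 0"
      "k = r * s" "y = t * w" "b = r * t" "a = s * w"
    by (rule four_number_lemma[OF _ less.prems(2) ab(2,1)])
  have cop: "coprime s t" "coprime r w"
    using less.prems(3) ab(3) rstw k by auto
  have "odd w" using \<open>odd y\<close> rstw by simp
  \<comment> \<open>This is \<open>y\<^sup>2 - x\<^sup>2 = a\<^sup>2 - b\<^sup>2\<close> in the four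
    factors, regrouped. Since \<open>t\<close>, \<open>s\<close> are coprime and so are the two
    sums, factors can be matched crosswise.\<close>
  have eq: "t\<^sup>2 * (w\<^sup>2 + r\<^sup>2) = s\<^sup>2 * (w\<^sup>2 + 4 * r\<^sup>2)"
    using ab(4) rstw k by (simp add: power_mult_distrib algebra_simps)
  \<comment> \<open>Parametrizing the first equation as a Pythagorean triple \<open>(w, 2 r, t)\<close> turns the second one
     into a smaller instance of the quartic equation.\<close>
  have st: "t\<^sup>2 = w\<^sup>2 + 4 * r\<^sup>2" "s\<^sup>2 = w\<^sup>2 + r\<^sup>2"
    using eq cop coprime_sum_squares[OF cop(2)]
      coprime_crossproduct_int[of "t\<^sup>2" "s\<^sup>2" "w\<^sup>2 + 4 * r\<^sup>2" "w\<^sup>2 + r\<^sup>2"]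
    by (simp_all add: coprime_commute)
  have "coprime w (2 * r)" using cop \<open>odd w\<close> by (simp add: coprime_commute)
  then obtain e f where ef: "e > 0" "f > 0" "coprime e f" "w = e\<^sup>2 - f\<^sup>2" "2 * r = 2 * e * f"
    using st \<open>odd w\<close> rstw primitive_pythagorean_triple[of w "2 * r" t] by (auto simp: power_mult_distrib)
  have r: "r = e * f" using ef by simp
  have s: "e^4 - e\<^sup>2 * f\<^sup>2 + f^4 = s\<^sup>2"
    using st ef r by (simp add: power2_eq_square power4_eq_xxxx algebra_simps)
  \<comment> \<open>The measure drops: \<open>e * f = r\<close>, whereas
    \<open>x * y = 2 * r * s * t * w\<close>.\<close>
  have "1 * 1 \<le> s * (t * w)" using rstw by (intro mult_mono) (auto simp: int_one_le_iff_zero_less)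
  then have "r * 1 \<le> r * (s * (t * w))" using rstw by (intro mult_left_mono) auto
  then have "r < x * y" using rstw k by (simp add: mult.assoc)
  then have small: "nat (e * f) < nat (x * y)" "nat (f * e) < nat (x * y)"
    using r rstw by (auto simp: mult.commute)
  \<comment> \<open>As \<open>w = e\<^sup>2 - f\<^sup>2\<close> is odd, one of \<open>e\<close>,
    \<open>f\<close> is even; by symmetry of the form it can take the place of
    \<open>x\<close>.\<close>
  have "even e \<or> even f" using ef \<open>odd w\<close> by auto
  then show False
    using less.hyps[OF small(1), of s] less.hyps[OF small(2), of s] ef s
    by (auto simp: coprime_commute algebra_simps)
qed

text \<open>An even entry is excluded by the descent. For odd entries the legs exchange parity:
  \<open>x * y\<close> is odd and the difference of squares even. Assuming
  \<open>x \<noteq> y\<close> makes the even leg nonzero, so the triple can be parametrized.\<close>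

lemma coprime_quartic_square_imp_eq:
  fixes x y z :: int
  assumes "x > 0" "y > 0" "coprime x y" "x^4 - x\<^sup>2 * y\<^sup>2 + y^4 = z\<^sup>2"
  shows "x = y"
proof (cases "even x \<or> even y")
  case True
  then show ?thesis
    using quartic_not_square_even[of x y z] quartic_not_square_even[of y x z] assms
    by (auto simp: coprime_commute algebra_simps)
next
  case False
  show ?thesis
  proof (rule ccontr)
    assume "x \<noteq> y"
    then have "\<bar>x\<^sup>2 - y\<^sup>2\<bar> > 0" using assms by (simp add: power2_eq_iff_nonneg)
    moreover have "coprime (x * y) \<bar>x\<^sup>2 - y\<^sup>2\<bar>"
      using coprime_diff_squares[OF assms(3)] by (simp add: coprime_commute)
    moreover have "(x * y)\<^sup>2 + \<bar>x\<^sup>2 - y\<^sup>2\<bar>\<^sup>2 = z\<^sup>2"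
      using assms(4) by (simp add: power2_eq_square power4_eq_xxxx algebra_simps)
    ultimately obtain a b where ab: "a > 0" "b > 0" "coprime a b"
        "x * y = a\<^sup>2 - b\<^sup>2" "\<bar>x\<^sup>2 - y\<^sup>2\<bar> = 2 * a * b"
      using False primitive_pythagorean_triple[of "x * y" "\<bar>x\<^sup>2 - y\<^sup>2\<bar>" z] by auto
    \<comment> \<open>\<open>h\<close> will be the square root of the quartic form at
      \<open>(a, b)\<close>, through \<open>(x\<^sup>2 + y\<^sup>2)\<^sup>2 = (x\<^sup>2 -
      y\<^sup>2)\<^sup>2 + 4 * (x * y)\<^sup>2\<close>.\<close>
    obtain h where h: "x\<^sup>2 + y\<^sup>2 = 2 * h" using False by (metis evenE even_add even_power)
    \<comment> \<open>For \<open>x\<close>, \<open>y\<close> both odd, \<open>(a, b)\<close> is a solution with an even component.\<close>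
    have "(2 * h)\<^sup>2 = \<bar>x\<^sup>2 - y\<^sup>2\<bar>\<^sup>2 + 4 * (x * y)\<^sup>2"
      unfolding h[symmetric] by (simp add: power2_eq_square algebra_simps)
    then have "h\<^sup>2 = (a * b)\<^sup>2 + (a\<^sup>2 - b\<^sup>2)\<^sup>2"
      unfolding ab(4,5) by (simp add: power_mult_distrib)
    then have h2: "a^4 - a\<^sup>2 * b\<^sup>2 + b^4 = h\<^sup>2"
      by (simp add: power2_eq_square power4_eq_xxxx algebra_simps)
    have "odd (a\<^sup>2 - b\<^sup>2)" using ab(4) False by (metis even_mult_iff)
    then have "even a \<or> even b" by auto
    then show False
      using quartic_not_square_even[of a b h] quartic_not_square_even[of b a h] ab h2
      by (auto simp: coprime_commute algebra_simps)
  qed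
qed

text \<open>The form is homogeneous of degree 4, so with \<open>x / y = m / n\<close> in lowest
  terms, \<open>z\<close> rescales to a rational \<open>v\<close> whose square is the form at the
  integers \<open>m\<close>, \<open>n\<close>.\<close>

lemma Rats_quartic_square_imp_eq:
  fixes x y z :: real
  assumes "x > 0" "y > 0" "x \<in> \<rat>" "y \<in> \<rat>" "z \<in> \<rat>" "x^4 - x\<^sup>2 * y\<^sup>2 + y^4 = z\<^sup>2"
  shows "x = y"
proof -
  obtain m n where mn: "n \<noteq> 0" "\<bar>x / y\<bar> = real m / real n" "coprime m n"
    using Rats_abs_nat_div_natE assms by (metis Rats_divide)
  have xy: "x = y * m / n" and mpos: "m > 0"
    using mn assms by (auto simp: field_simps intro!: Nat.gr0I)
  define v where "v = z * n\<^sup>2 / y\<^sup>2"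
  have "v \<in> \<rat>" using assms by (simp add: v_def)
  have v: "v\<^sup>2 = of_int (int m ^ 4 - (int m)\<^sup>2 * (int n)\<^sup>2 + int n ^ 4)"
  proof -
    have "v\<^sup>2 = (x^4 - x\<^sup>2 * y\<^sup>2 + y^4) * n^4 / y^4"
      using assms by (simp add: v_def power_mult_distrib power_divide)
    also have "\<dots> = real m ^ 4 - (real m)\<^sup>2 * (real n)\<^sup>2 + real n ^ 4"
      unfolding xy using mn assms by (simp add: field_simps power2_eq_square power4_eq_xxxx)
    finally show ?thesis by simp
  qed
  \<comment> \<open>Up to sign, \<open>v\<close> is the root of an integer; a rational algebraic
    integer is an integer.\<close>
  have "algebraic_int (sqrt (v\<^sup>2))" unfolding v by (intro algebraic_int_sqrt int_imp_algebraic_int Ints_of_int)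
  then have "algebraic_int v" by simp
  then have "v \<in> \<int>" using rational_algebraic_int_is_int \<open>v \<in> \<rat>\<close> by blast
  then obtain k where "v = of_int k" by (auto elim: Ints_cases)
  with v have "int m ^ 4 - (int m)\<^sup>2 * (int n)\<^sup>2 + int n ^ 4 = k\<^sup>2"
    by (simp only: of_int_power[symmetric] of_int_eq_iff)
  then have "int m = int n" using coprime_quartic_square_imp_eq[of "int m" "int n" k] mn(1,3) mpos by simp
  then show ?thesis using xy mn by simp
qed

section \<open>Spherical trigonometry of equilateral triangles\<close>

definition orthonormal_triple :: "real ^ 3 \<Rightarrow> real ^ 3 \<Rightarrow> real ^ 3 \<Rightarrow> bool" where
  "orthonormal_triple A B C \<longleftrightarrow>
     norm A = 1 \<and> norm B = 1 \<and> norm C = 1 \<and> A \<bullet> B = 0 \<and> B \<bullet> C = 0 \<and> C \<bullet> A = 0"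

lemma abs_inner_unit_le_1:
  fixes x y :: "'a :: real_inner"
  assumes "norm x = 1" "norm y = 1"
  shows "\<bar>x \<bullet> y\<bar> \<le> 1"
  using Cauchy_Schwarz_ineq2[of x y] assms by simp

lemma sphere_dist_inj:
  assumes "norm A = 1" "norm B = 1" "norm C = 1" "norm D = 1"
  shows "sphere_dist A B = sphere_dist C D \<longleftrightarrow> A \<bullet> B = C \<bullet> D"
  using assms by (simp add: sphere_dist_def arccos_eq_iff abs_inner_unit_le_1)

lemma cos_sphere_angle:
  "cos (sphere_angle A B C) = (tangent A B \<bullet> tangent A C) / (norm (tangent A B) * norm (tangent A C))"
proof -
  have "\<bar>tangent A B \<bullet> tangent A C\<bar> \<le> norm (tangent A B) * norm (tangent A C)"
    by (rule Cauchy_Schwarz_ineq2)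
  \<comment> \<open>If a tangent vanishes, the quotient is 0 by the convention for division, so the
    bound covers this case too.\<close>
  then have "\<bar>(tangent A B \<bullet> tangent A C) / (norm (tangent A B) * norm (tangent A C))\<bar> \<le> 1"
    by (auto simp: abs_mult divide_le_eq_1 zero_less_mult_iff)
  then show ?thesis by (simp only: sphere_angle_def cos_arccos_abs)
qed

lemma inner_tangent:
  assumes "norm A = 1"
  shows "tangent A B \<bullet> tangent A C = B \<bullet> C - (A \<bullet> B) * (A \<bullet> C)"
  using assms by (simp add: tangent_def algebra_simps inner_commute dot_square_norm)

lemma norm_tangent:
  assumes "norm A = 1" "norm B = 1"
  shows "norm (tangent A B) = sqrt (1 - (A \<bullet> B)\<^sup>2)"
  unfolding norm_eq_sqrt_inner[of "tangent A B"] inner_tangent[OF assms(1)]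
  by (simp add: dot_square_norm assms flip: power2_eq_square)

text \<open>The spherical law of cosines gives \<open>(c - c\<^sup>2) / (1 - c\<^sup>2)\<close>, and
  the factor \<open>1 - c\<close> cancels.\<close>

lemma cos_sphere_angle_equilateral:
  assumes "norm A = 1" "norm B = 1" "norm C = 1"
    and "A \<bullet> B = c" "A \<bullet> C = c" "B \<bullet> C = c" "\<bar>c\<bar> < 1"
  shows "cos (sphere_angle A B C) = c / (1 + c)"
proof -
  have "norm (tangent A B) = sqrt (1 - c\<^sup>2)" "norm (tangent A C) = sqrt (1 - c\<^sup>2)"
    using assms by (simp_all add: norm_tangent)
  moreover have "c\<^sup>2 \<le> 1" using \<open>\<bar>c\<bar> < 1\<close> by (simp add: abs_square_le_1)
  ultimately have "norm (tangent A B) * norm (tangent A C) = 1 - c\<^sup>2"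
    by simp
  then have "norm (tangent A B) * norm (tangent A C) = (1 + c) * (1 - c)"
    by (simp add: power2_eq_square algebra_simps)
  moreover have "tangent A B \<bullet> tangent A C = c * (1 - c)"
    using assms by (simp add: inner_tangent algebra_simps)
  ultimately show ?thesis
    unfolding cos_sphere_angle using \<open>\<bar>c\<bar> < 1\<close> by simp
qed

lemma rational_equilateral_imp_orthonormal:
  assumes "rational_equilateral_triangle A B C"
  shows "orthonormal_triple A B C"
proof -
  have unit: "norm A = 1" "norm B = 1" "norm C = 1"
    using assms by (auto simp: rational_equilateral_triangle_def proper_spherical_triangle_def)
  have side: "0 < sphere_dist A B" "sphere_dist A B < pi" "rational_angle (sphere_dist A B)"
    and angle: "0 < sphere_angle A B C" "sphere_angle A B C < pi" "rational_angle (sphere_angle A B C)"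
    and eq: "A \<bullet> B = B \<bullet> C" "C \<bullet> A = B \<bullet> C"
    using assms sphere_dist_inj unit
    by (auto simp: rational_equilateral_triangle_def proper_spherical_triangle_def equilateral_def
        rational_sides_and_angles_def side_lengths_def angles_def)
  define c where "c = A \<bullet> B"
  define s where "s = sin (sphere_dist A B)"
  define r where "r = (1 + c) * sin (sphere_angle A B C)"
  have cos: "cos (sphere_dist A B) = c"
    using abs_inner_unit_le_1[of A B] unit by (simp add: sphere_dist_def c_def cos_arccos_abs)
  have "s > 0" using side by (simp add: s_def sin_gt_zero)
  have s2: "s\<^sup>2 = 1 - c\<^sup>2" by (simp add: s_def sin_squared_eq cos)
  then have "c\<^sup>2 < 1" using zero_less_power[OF \<open>s > 0\<close>, of 2] by simp
  then have "\<bar>c\<bar> < 1" by (simp add: abs_square_less_1)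
  have "cos (sphere_angle A B C) = c / (1 + c)"
    using eq by (intro cos_sphere_angle_equilateral unit \<open>\<bar>c\<bar> < 1\<close>)
      (auto simp: c_def inner_commute[of A C])
  then have "r\<^sup>2 = (1 + c)\<^sup>2 * (1 - (c / (1 + c))\<^sup>2)"
    by (simp add: r_def power_mult_distrib sin_squared_eq)
  also have "\<dots> = (1 + c)\<^sup>2 - c\<^sup>2"
    using \<open>\<bar>c\<bar> < 1\<close> by (simp add: power_divide right_diff_distrib)
  finally have r2: "r\<^sup>2 = 1 + 2 * c"
    by (simp add: power2_eq_square algebra_simps)
  have "r > 0" using angle \<open>\<bar>c\<bar> < 1\<close> by (simp add: r_def sin_gt_zero)
  have rat: "c \<in> \<rat>" "s \<in> \<rat>" "r \<in> \<rat>"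
    using side angle cos by (auto simp: rational_angle_def s_def r_def)
  have "s^4 - s\<^sup>2 * r\<^sup>2 + r^4 = (s\<^sup>2)\<^sup>2 - s\<^sup>2 * r\<^sup>2 + (r\<^sup>2)\<^sup>2"
    by simp
  also have "\<dots> = (c\<^sup>2 + c + 1)\<^sup>2"
    unfolding s2 r2 by (simp add: power2_eq_square algebra_simps)
  finally have "s = r"
    using \<open>s > 0\<close> \<open>r > 0\<close> rat by (intro Rats_quartic_square_imp_eq[of s r "c\<^sup>2 + c + 1"]) auto
  \<comment> \<open>Equating \<open>1 - c\<^sup>2\<close> with \<open>1 + 2 * c\<close>; the root -2
    is then excluded by \<open>\<bar>c\<bar> < 1\<close>.\<close>
  then have "c * (c + 2) = 0"
    using s2 r2 by (simp add: power2_eq_square algebra_simps)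
  then have "c = 0" using \<open>\<bar>c\<bar> < 1\<close> by auto
  then show ?thesis
    using unit eq by (simp add: orthonormal_triple_def c_def)
qed

section \<open>Sides, angles and medians of the octant triangle\<close>

lemma tangent_orthogonal: "A \<bullet> B = 0 \<Longrightarrow> tangent A B = B"
  by (simp add: tangent_def)

text \<open>The definite description needs a unique midpoint: projecting the chord point with
  parameter \<open>u\<close>, equidistance amounts to \<open>1 - u = u\<close>. Membership in the
  arc is all that the medians require.\<close>

lemma arc_midpoint_in_great_arc:
  assumes "norm B = 1" "norm C = 1" "B \<bullet> C = 0"
  shows "arc_midpoint B C \<in> great_arc B C"
proof -
  let ?P = "\<lambda>u::real. (1 - u) *\<^sub>R B + u *\<^sub>R C"
  \<comment> \<open>The inner products with \<open>B\<close> and \<open>C\<close> are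
    \<open>1 - u\<close> and \<open>u\<close>, which cannot both vanish.\<close>
  have nz: "?P u \<noteq> 0" for u
  proof
    assume "?P u = 0"
    then have "?P u \<bullet> B = 0" "?P u \<bullet> C = 0" by simp_all
    then show False using assms by (simp add: algebra_simps inner_commute dot_square_norm)
  qed
  have equi: "sphere_dist B (sgn (?P u)) = sphere_dist (sgn (?P u)) C \<longleftrightarrow> u = 1 / 2" for u
  proof -
    have "sphere_dist B (sgn (?P u)) = sphere_dist (sgn (?P u)) C \<longleftrightarrow>
        B \<bullet> sgn (?P u) = sgn (?P u) \<bullet> C"
      using assms nz by (intro sphere_dist_inj) (simp_all add: norm_sgn)
    also have "\<dots> \<longleftrightarrow> B \<bullet> ?P u = ?P u \<bullet> C"
      using nz[of u] by (simp only: sgn_div_norm inner_scaleR_left inner_scaleR_right) simp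
    also have "\<dots> \<longleftrightarrow> u = 1 / 2"
      using assms by (auto simp: inner_simps inner_commute dot_square_norm)
    finally show ?thesis .
  qed
  have arc: "sgn (?P (1 / 2)) \<in> great_arc B C"
    unfolding great_arc_def by (rule imageI) (auto simp: in_segment intro!: exI[of _ "1 / 2"])
  have "\<exists>!M. M \<in> great_arc B C \<and> sphere_dist B M = sphere_dist M C"
  proof (rule ex1I)
    show "sgn (?P (1 / 2)) \<in> great_arc B C \<and>
        sphere_dist B (sgn (?P (1 / 2))) = sphere_dist (sgn (?P (1 / 2))) C"
      using arc equi by blast
  next
    fix M assume M: "M \<in> great_arc B C \<and> sphere_dist B M = sphere_dist M C"
    then obtain u where u: "M = sgn (?P u)" by (auto simp: great_arc_def closed_segment_def)
    with M equi[of u] have "u = 1 / 2" by blast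
    with u show "M = sgn (?P (1 / 2))" by (simp only:)
  qed
  from theI'[OF this] show ?thesis unfolding arc_midpoint_def by blast
qed

text \<open>\<open>A\<close> is a pole of the great circle through \<open>B\<close> and
  \<open>C\<close>, so the position of \<open>M\<close> on the arc does not matter.\<close>

lemma sphere_dist_orthogonal_arc:
  assumes "A \<bullet> B = 0" "A \<bullet> C = 0" "M \<in> great_arc B C"
  shows "sphere_dist A M = pi / 2"
proof -
  have "A \<bullet> M = 0"
    using assms by (auto simp: great_arc_def closed_segment_def sgn_div_norm inner_add_right)
  then show ?thesis by (simp add: sphere_dist_def)
qed

lemma orthonormal_triple_measures:
  assumes "orthonormal_triple A B C"
  shows "side_lengths A B C = {pi / 2}" "angles A B C = {pi / 2}" "median_lengths A B C = {pi / 2}"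
proof -
  note on = assms[unfolded orthonormal_triple_def]
  then have on': "B \<bullet> A = 0" "C \<bullet> B = 0" "A \<bullet> C = 0" by (simp_all add: inner_commute)
  show "side_lengths A B C = {pi / 2}"
    using on by (simp add: side_lengths_def sphere_dist_def)
  show "angles A B C = {pi / 2}"
    using on on' by (simp add: angles_def sphere_angle_def tangent_orthogonal)
  have "sphere_dist A (arc_midpoint B C) = pi / 2" "sphere_dist B (arc_midpoint C A) = pi / 2"
    "sphere_dist C (arc_midpoint A B) = pi / 2"
    by (rule sphere_dist_orthogonal_arc[OF _ _ arc_midpoint_in_great_arc]; use on on' in simp)+
  then show "median_lengths A B C = {pi / 2}" by (simp add: median_lengths_def)
qed

lemma rational_angle_half_pi: "rational_angle (pi / 2)"
  by (simp add: rational_angle_def)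

lemma rational_equilateral_iff_orthonormal:
  "rational_equilateral_triangle A B C \<longleftrightarrow> orthonormal_triple A B C"
proof
  assume on: "orthonormal_triple A B C"
  note m = orthonormal_triple_measures[OF this]
  have "equilateral A B C" using on by (simp add: equilateral_def sphere_dist_def orthonormal_triple_def)
  then show "rational_equilateral_triangle A B C"
    using on m rational_angle_half_pi
    by (simp add: rational_equilateral_triangle_def proper_spherical_triangle_def
        rational_sides_and_angles_def orthonormal_triple_def)
qed (rule rational_equilateral_imp_orthonormal)

section \<open>Congruence by orthogonal matrices\<close>

lemma orthonormal_triple_matrix:
  assumes "orthonormal_triple A B C"
  defines "M \<equiv> transpose (vector [A, B, C]) :: real ^ 3 ^ 3"
  shows "orthogonal_matrix M"
    and "M *v axis 1 1 = A" "M *v axis 2 1 = B" "M *v axis 3 1 = C"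
proof -
  \<comment> \<open>\<open>vector [A, B, C]\<close> lists rows; transposing turns the vertices into
    columns, the images of the standard basis.\<close>
  have col: "column 1 M = A" "column 2 M = B" "column 3 M = C"
    by (simp_all add: M_def row_def vec_lambda_eta)
  then show "M *v axis 1 1 = A" "M *v axis 2 1 = B" "M *v axis 3 1 = C"
    by (simp_all add: matrix_vector_mult_basis)
  show "orthogonal_matrix M"
    using assms(1) unfolding orthogonal_matrix_orthonormal_columns
    by (simp add: forall_3 col orthonormal_triple_def orthogonal_def inner_commute)
qed

text \<open>\<open>transpose M\<close> inverts \<open>M\<close> and so takes the first triple to the
  standard basis, which \<open>N\<close> takes to the second. Reflections count as congruences, so
  orientation is no obstacle.\<close>

lemma orthonormal_triples_congruent:
  assumes "orthonormal_triple A B C" "orthonormal_triple A' B' C'"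
  shows "congruent_triangles A B C A' B' C'"
proof -
  obtain M where M: "orthogonal_matrix M"
      "M *v axis 1 1 = A" "M *v axis 2 1 = B" "M *v axis 3 1 = C"
    using orthonormal_triple_matrix[OF assms(1)] by blast
  obtain N where N: "orthogonal_matrix N"
      "N *v axis 1 1 = A'" "N *v axis 2 1 = B'" "N *v axis 3 1 = C'"
    using orthonormal_triple_matrix[OF assms(2)] by blast
  let ?Q = "N ** transpose M"
  have "orthogonal_matrix ?Q"
    using M N by (intro orthogonal_matrix_mul) simp_all
  then have "orthogonal_transformation ((*v) ?Q)"
    by (simp add: orthogonal_transformation_matrix)
  moreover have "?Q *v (M *v x) = N *v x" for x
    using M(1) by (simp add: matrix_vector_mul_assoc orthogonal_matrix_def flip: matrix_mul_assoc)
  ultimately show ?thesis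
    unfolding congruent_triangles_def using M(2-4) N(2-4) by metis
qed

theorem theorem3:
  "(\<exists>A B C. rational_equilateral_triangle A B C) \<and>
   (\<forall>A B C A' B' C'.
      rational_equilateral_triangle A B C \<and> rational_equilateral_triangle A' B' C' \<longrightarrow>
      congruent_triangles A B C A' B' C') \<and>
   (\<forall>A B C. rational_equilateral_triangle A B C \<longrightarrow>
      side_lengths A B C = {pi / 2} \<and> angles A B C = {pi / 2} \<and>
      median_lengths A B C = {pi / 2} \<and> (\<forall>m \<in> median_lengths A B C. rational_angle m))"
proof -
  have "orthonormal_triple (axis 1 1) (axis 2 1) (axis 3 1)"
    by (simp add: orthonormal_triple_def inner_axis_axis)
  then show ?thesis
    unfolding rational_equilateral_iff_orthonormal
    using orthonormal_triples_congruent orthonormal_triple_measures rational_angle_half_pi by auto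
qed

end
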